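(* (1) For every positive integer $n$, the Scott space $\Sigma\operatorname{RO}(\mathbb R^n)$ is not sober. (2) The Scott space $\Sigma\operatorname{RO}(2^{\mathbb N})$ is not sober.
   Context: $\mathbb R^n$ is $n$-dimensional Euclidean space and $2^{\mathbb N}=\prod_{n\in\mathbb N}\{0,1\}$ is the Cantor space with the product topology ($\{0,1\}$ discrete). For a topological space $X$, an open set $U\subseteq X$ is regular open if $U=\operatorname{int}_X(\operatorname{cl}_X(U))$; $\operatorname{RO}(X)$ is the set of all regular open subsets of $X$ ordered by inclusion (a complete Boolean algebra). For a poset $P$, a subset $U$ is Scott open if it is an upper set and, for each directed $D\subseteq P$ whose supremum exists, $\bigvee D\in U$ implies $D\cap U\neq\emptyset$; $\Sigma P$ denotes $P$ with the topology of Scott open sets (the Scott space of $P$). A nonempty subset $A$ of a space is irreducible if, whenever $A\subseteq C_1\cup C_2$ with $C_1,C_2$ closed, $A\subseteq C_1$ or $A\subseteq C_2$. A $T_0$ space is sober if every irreducible closed set is the closure of a singleton. *)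

theory Defs
  imports "HOL-Analysis.Analysis" "HOL-Library.Lub_Glb"
begin

(* A poset is a set P in a type of class order, with the order inherited from the type. *)

definition directed :: "'a::order set \<Rightarrow> bool" where
  "directed D \<longleftrightarrow> D \<noteq> {} \<and> (\<forall>x\<in>D. \<forall>y\<in>D. \<exists>z\<in>D. x \<le> z \<and> y \<le> z)"

(* isLub P D s says that s is the least among the upper bounds of D that lie in P,
   so suprema are taken in P and not in the ambient type. *)
definition scott_open :: "'a::order set \<Rightarrow> 'a set \<Rightarrow> bool" where
  "scott_open P U \<longleftrightarrow>
     U \<subseteq> P \<and>
     (\<forall>x\<in>U. \<forall>y\<in>P. x \<le> y \<longrightarrow> y \<in> U) \<and>
     (\<forall>D s. D \<subseteq> P \<and> directed D \<and> isLub P D s \<and> s \<in> U \<longrightarrow> D \<inter> U \<noteq> {})"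

definition scott_space :: "'a::order set \<Rightarrow> 'a topology" where
  "scott_space P = topology (scott_open P)"

lemma
  assumes "scott_open P U"
  shows scott_open_subset: "U \<subseteq> P"
    and scott_open_upper: "\<And>x y. x \<in> U \<Longrightarrow> y \<in> P \<Longrightarrow> x \<le> y \<Longrightarrow> y \<in> U"
    and scott_open_lub: "\<And>D s. D \<subseteq> P \<Longrightarrow> directed D \<Longrightarrow> isLub P D s \<Longrightarrow> s \<in> U \<Longrightarrow> \<exists>d\<in>D. d \<in> U"
  using assms unfolding scott_open_def by (simp, meson, meson disjoint_iff)

lemma scott_openI:
  assumes "U \<subseteq> P"
    and "\<And>x y. x \<in> U \<Longrightarrow> y \<in> P \<Longrightarrow> x \<le> y \<Longrightarrow> y \<in> U"
    and "\<And>D s. D \<subseteq> P \<Longrightarrow> directed D \<Longrightarrow> isLub P D s \<Longrightarrow> s \<in> U \<Longrightarrow> \<exists>d\<in>D. d \<in> U"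
  shows "scott_open P U"
  unfolding scott_open_def using assms by (meson disjoint_iff)

lemma istopology_scott_open: "istopology (scott_open P)"
  unfolding istopology_def
proof (intro conjI allI impI)
  fix U V assume U: "scott_open P U" and V: "scott_open P V"
  show "scott_open P (U \<inter> V)"
  proof (rule scott_openI)
    show "U \<inter> V \<subseteq> P"
      using scott_open_subset[OF U] by blast
    show "y \<in> U \<inter> V" if "x \<in> U \<inter> V" "y \<in> P" "x \<le> y" for x y
      using scott_open_upper[OF U] scott_open_upper[OF V] that by blast
    fix D s assume D: "D \<subseteq> P" "directed D" "isLub P D s" and s: "s \<in> U \<inter> V"
    obtain x where x: "x \<in> D" "x \<in> U"
      using scott_open_lub[OF U D] s by blast
    obtain y where y: "y \<in> D" "y \<in> V"
      using scott_open_lub[OF V D] s by blast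
    obtain z where z: "z \<in> D" "x \<le> z" "y \<le> z"
      using D(2) x(1) y(1) unfolding directed_def by blast
    have "z \<in> P"
      using z(1) D(1) by blast
    then have "z \<in> U \<inter> V"
      using scott_open_upper[OF U x(2)] scott_open_upper[OF V y(2)] z by blast
    then show "\<exists>d\<in>D. d \<in> U \<inter> V"
      using z(1) by blast
  qed
next
  fix K assume K: "\<forall>U\<in>K. scott_open P U"
  show "scott_open P (\<Union> K)"
  proof (rule scott_openI)
    show "\<Union> K \<subseteq> P"
      using K scott_open_subset by blast
    show "y \<in> \<Union> K" if "x \<in> \<Union> K" "y \<in> P" "x \<le> y" for x y
      using K scott_open_upper that by (meson Union_iff)
    show "\<exists>d\<in>D. d \<in> \<Union> K"
      if "D \<subseteq> P" "directed D" "isLub P D s" "s \<in> \<Union> K" for D s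
      using K scott_open_lub[OF _ that(1-3)] that(4) by (meson Union_iff)
  qed
qed

lemma openin_scott_space [simp]: "openin (scott_space P) U \<longleftrightarrow> scott_open P U"
  unfolding scott_space_def by (simp add: istopology_scott_open)

lemma topspace_scott_space [simp]: "topspace (scott_space P) = P"
proof -
  have "scott_open P P"
    unfolding scott_open_def directed_def by blast
  then show ?thesis
    unfolding topspace_def by (auto simp: scott_open_def)
qed

lemma t0_space_scott_space: "t0_space (scott_space P)"
proof -
  have "scott_open P {z \<in> P. \<not> z \<le> y}" if "y \<in> P" for y
    unfolding scott_open_def
  proof (intro conjI ballI allI impI)
    show "{z \<in> P. \<not> z \<le> y} \<subseteq> P" by blast
    show "v \<in> {z \<in> P. \<not> z \<le> y}" if "u \<in> {z \<in> P. \<not> z \<le> y}" "v \<in> P" "u \<le> v" for u v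
      using that order_trans by blast
    fix D s
    assume *: "D \<subseteq> P \<and> directed D \<and> isLub P D s \<and> s \<in> {z \<in> P. \<not> z \<le> y}"
    show "D \<inter> {z \<in> P. \<not> z \<le> y} \<noteq> {}"
    proof
      assume "D \<inter> {z \<in> P. \<not> z \<le> y} = {}"
      then have "isUb P D y"
        using * that unfolding isUb_def setle_def by blast
      then have "s \<le> y"
        using * isLub_le_isUb by blast
      then show False using * by blast
    qed
  qed
  then have sep: "\<exists>U. scott_open P U \<and> x \<in> U \<and> y \<notin> U"
    if "x \<in> P" "y \<in> P" "\<not> x \<le> y" for x y
    using that by (intro exI[of _ "{z \<in> P. \<not> z \<le> y}"]) simp
  show ?thesis
    unfolding t0_space_def topspace_scott_space openin_scott_space
  proof (intro ballI impI)
    fix x y assume "x \<in> P" "y \<in> P" "x \<noteq> y"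
    then show "\<exists>U. scott_open P U \<and> (x \<notin> U \<longleftrightarrow> y \<in> U)"
      using sep[of x y] sep[of y x] order_antisym[of x y] by blast
  qed
qed

definition irreducible_in :: "'a topology \<Rightarrow> 'a set \<Rightarrow> bool" where
  "irreducible_in X A \<longleftrightarrow>
     A \<subseteq> topspace X \<and> A \<noteq> {} \<and>
     (\<forall>C1 C2. closedin X C1 \<and> closedin X C2 \<and> A \<subseteq> C1 \<union> C2 \<longrightarrow> A \<subseteq> C1 \<or> A \<subseteq> C2)"

definition sober_space :: "'a topology \<Rightarrow> bool" where
  "sober_space X \<longleftrightarrow>
     t0_space X \<and>
     (\<forall>A. closedin X A \<and> irreducible_in X A \<longrightarrow> (\<exists>x\<in>topspace X. A = X closure_of {x}))"

(* Regarded as a poset, RO X carries the order of the type of sets, that is, inclusion. *)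
definition RO :: "'a topology \<Rightarrow> 'a set set" where
  "RO X = {U. openin X U \<and> U = X interior_of (X closure_of U)}"

definition cantor_space :: "(nat \<Rightarrow> nat) topology" where
  "cantor_space = product_topology (\<lambda>_. discrete_topology {0, 1}) UNIV"

end

theory Submission
  imports Defs
begin

text \<open>
  Let \<sigma> be an involution of X moving some nonempty open set off itself, and let A consist of the
  regular open u with u \<inter> \<sigma> u empty. A is Scott closed, and it has no greatest element since it
  is \<sigma>-invariant. It is irreducible because the regular open algebra badly fails weak
  distributivity: shrinking symmetric neighbourhoods e of the points of a countable dense set may
  be made arbitrarily small one after the other, yet their union stays dense. Given u, v in A
  and Scott open sets V, W around them, replace u by v on e. Choosing each new neighbourhood small
  enough never leaves V, while the copied parts of v increase to v, so that eventually W is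
  reached as well.
\<close>

section \<open>Regular open sets\<close>

text \<open>For open \<open>U\<close> this is the least regular open set containing
  \<open>U\<close>; suprema in \<open>RO X\<close> are therefore regularized unions, usually larger
  than the unions themselves.\<close>

definition regularize :: "'a topology \<Rightarrow> 'a set \<Rightarrow> 'a set" where
  "regularize X U = X interior_of (X closure_of U)"

lemma openin_regularize [simp]: "openin X (regularize X U)"
  by (simp add: regularize_def)

lemma regularize_mono: "U \<subseteq> V \<Longrightarrow> regularize X U \<subseteq> regularize X V"
  by (simp add: regularize_def closure_of_mono interior_of_mono)

lemma regularize_subset_closure_of: "regularize X U \<subseteq> X closure_of U"
  by (simp add: regularize_def interior_of_subset)

lemma regularize_subset: "U \<subseteq> X closure_of V \<Longrightarrow> regularize X U \<subseteq> regularize X V"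
  unfolding regularize_def
  by (metis closedin_closure_of closure_of_minimal interior_of_mono)

lemma subset_regularize: "openin X U \<Longrightarrow> U \<subseteq> regularize X U"
  by (simp add: regularize_def interior_of_maximal_eq closure_of_subset openin_subset)

lemma regularize_in_RO [simp]: "regularize X U \<in> RO X"
proof -
  have "regularize X (regularize X U) = regularize X U"
    by (simp add: regularize_subset regularize_subset_closure_of subset_antisym subset_regularize)
  then show ?thesis
    by (simp add: RO_def regularize_def)
qed

lemma RO_iff: "U \<in> RO X \<longleftrightarrow> openin X U \<and> regularize X U = U"
  by (auto simp: RO_def regularize_def)

lemma regularize_least: "U \<subseteq> V \<Longrightarrow> V \<in> RO X \<Longrightarrow> regularize X U \<subseteq> V"
  by (metis RO_iff regularize_mono)

lemma openin_Union_RO: "D \<subseteq> RO X \<Longrightarrow> openin X (\<Union>D)"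
  by (rule openin_Union) (auto simp: RO_iff)

lemma isLub_RO:
  assumes "D \<subseteq> RO X"
  shows "isLub (RO X) D (regularize X (\<Union>D))"
proof (rule isLubI2)
  have "openin X (\<Union>D)"
    using assms by (rule openin_Union_RO)
  then show "isUb (RO X) D (regularize X (\<Union>D))"
    using subset_regularize[of X "\<Union>D"] by (intro isUbI setleI) auto
  show "regularize X (\<Union>D) <=* Collect (isUb (RO X) D)"
  proof (rule setgeI, rule ballI)
    fix y assume "y \<in> Collect (isUb (RO X) D)"
    then show "regularize X (\<Union>D) \<subseteq> y"
      by (intro regularize_least Union_least) (auto simp: isUb_def setle_def)
  qed
qed

lemma isLub_RO_eq:
  assumes "D \<subseteq> RO X" "isLub (RO X) D s"
  shows "s = regularize X (\<Union>D)"
  using isLub_RO[OF assms(1)] assms(2) by (intro order_antisym isLub_le_isUb[of _ D] isLub_isUb)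

section \<open>Density arguments for Scott open sets of regular open sets\<close>

lemma openin_subset_closure_of_Int_dense:
  assumes "openin X U" "X closure_of E = topspace X"
  shows "U \<subseteq> X closure_of (U \<inter> E)"
proof -
  have "U \<inter> X closure_of E \<subseteq> X closure_of (U \<inter> E)"
    using assms(1) by (simp add: openin_Int_closure_of_subset)
  then show ?thesis
    using assms openin_subset by blast
qed

text \<open>The sets \<open>regularize X (F n)\<close> form a chain, and its supremum lies above
  \<open>regularize X U\<close> because the union of the \<open>F n\<close> is dense in
  \<open>U\<close>. Covering \<open>U\<close> up to closure thus suffices to use Scott
  openness.\<close>

lemma scott_open_RO_incseq:
  assumes V: "scott_open (RO X) V" and F: "\<And>n. openin X (F n)" "incseq F"
    and U: "U \<subseteq> X closure_of (\<Union>n. F n)" "regularize X U \<in> V"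
  shows "\<exists>n. regularize X (F n) \<in> V"
proof -
  let ?D = "range (\<lambda>n. regularize X (F n))"
  have D: "?D \<subseteq> RO X"
    by auto
  have inc: "regularize X (F m) \<subseteq> regularize X (F n)" if "m \<le> n" for m n
    using F(2) that by (simp add: incseq_def regularize_mono)
  have "directed ?D"
    unfolding directed_def
  proof (intro conjI ballI)
    fix x y assume "x \<in> ?D" "y \<in> ?D"
    then obtain m n where "x = regularize X (F m)" "y = regularize X (F n)"
      by blast
    then have "x \<subseteq> regularize X (F (max m n))" "y \<subseteq> regularize X (F (max m n))"
      using inc by simp_all
    then show "\<exists>z\<in>?D. x \<subseteq> z \<and> y \<subseteq> z"
      by blast
  qed blast
  moreover have "regularize X (\<Union>?D) \<in> V"
  proof (rule scott_open_upper[OF V U(2)])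
    have "(\<Union>n. F n) \<subseteq> \<Union>?D"
      using subset_regularize[OF F(1)] by blast
    then show "regularize X U \<subseteq> regularize X (\<Union>?D)"
      using U(1) closure_of_mono by (intro regularize_subset) blast
  qed simp
  ultimately show ?thesis
    using scott_open_lub[OF V D _ isLub_RO[OF D]] by blast
qed

text \<open>The elements not below \<open>x\<close> form a Scott open set that misses
  \<open>x\<close>. A Scott closed set that is the closure of a point therefore has that point as
  its greatest element.\<close>

lemma scott_closure_of_singleton_le:
  assumes "x \<in> P" "y \<in> scott_space P closure_of {x}"
  shows "y \<le> x"
proof -
  have "scott_open P {z \<in> P. \<not> z \<le> x}"
  proof (rule scott_openI)
    fix D s
    assume D: "D \<subseteq> P" "isLub P D s" and s: "s \<in> {z \<in> P. \<not> z \<le> x}"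
    show "\<exists>d\<in>D. d \<in> {z \<in> P. \<not> z \<le> x}"
    proof (rule ccontr)
      assume "\<not> ?thesis"
      then have "isUb P D x"
        using D(1) assms(1) unfolding isUb_def setle_def by blast
      then show False
        using isLub_le_isUb[OF D(2)] s by blast
    qed
  qed (auto dest: order_trans)
  then show ?thesis
    using assms(2)
    by (metis (no_types, lifting) in_closure_of mem_Collect_eq openin_scott_space order_refl
        singletonD topspace_scott_space)
qed

section \<open>Sets displaced by an involution\<close>

text \<open>The argument uses no more symmetry than this, so it covers both negation on Euclidean
  space and the flip of one coordinate on the Cantor space. The latter is an involution on
  \<open>topspace X\<close> only.\<close>

locale displacing_involution =
  fixes X :: "'a topology" and \<sigma> :: "'a \<Rightarrow> 'a"
  assumes continuous: "continuous_map X X \<sigma>"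
    and involutive: "x \<in> topspace X \<Longrightarrow> \<sigma> (\<sigma> x) = x"
begin

definition displaced :: "'a set set" where
  "displaced = {u \<in> RO X. \<forall>x\<in>u. \<sigma> x \<notin> u}"

definition invariant :: "'a set \<Rightarrow> bool" where
  "invariant e \<longleftrightarrow> (\<forall>x\<in>e. \<sigma> x \<in> e)"

lemma image_eq_vimage:
  assumes "U \<subseteq> topspace X"
  shows "\<sigma> ` U = {x \<in> topspace X. \<sigma> x \<in> U}"
proof -
  have "\<sigma> x \<in> topspace X" if "x \<in> topspace X" for x
    using continuous that continuous_map_image_subset_topspace[of X X \<sigma>] by blast
  then show ?thesis
    using assms involutive by force
qed

lemma openin_image: "openin X U \<Longrightarrow> openin X (\<sigma> ` U)"
  using openin_continuous_map_preimage[OF continuous] by (metis image_eq_vimage openin_subset)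

text \<open>Suppose \<open>x\<close> and \<open>\<sigma> x\<close> both lie in the regularization.
  Then \<open>?N\<close>, an open neighbourhood of \<open>x\<close>, meets \<open>U\<close>. The
  image of \<open>?N \<inter> U\<close> is open and contains a point of the closure of
  \<open>U\<close>, so it meets \<open>U\<close> as well: some point of \<open>U\<close> is sent
  into \<open>U\<close>.\<close>

lemma regularize_displaced:
  assumes "openin X U" "\<And>x. x \<in> U \<Longrightarrow> \<sigma> x \<notin> U"
  shows "regularize X U \<in> displaced"
proof -
  have False if x: "x \<in> regularize X U" "\<sigma> x \<in> regularize X U" for x
  proof -
    let ?N = "regularize X U \<inter> {x \<in> topspace X. \<sigma> x \<in> regularize X U}"
    have N: "openin X ?N"
      using continuous by (intro openin_Int openin_continuous_map_preimage) auto
    have "x \<in> ?N"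
      using x openin_subset[OF openin_regularize[of X U]] by blast
    moreover have "x \<in> X closure_of U"
      using x regularize_subset_closure_of[of X U] by blast
    ultimately have "?N \<inter> U \<noteq> {}"
      using openin_Int_closure_of_eq_empty[OF N, of U] by blast
    then obtain y where y: "y \<in> U" "y \<in> ?N"
      by blast
    have o: "openin X (\<sigma> ` (?N \<inter> U))"
      using openin_image[OF openin_Int[OF N assms(1)]] .
    have "\<sigma> y \<in> \<sigma> ` (?N \<inter> U)"
      using y by blast
    moreover have "\<sigma> y \<in> X closure_of U"
      using y regularize_subset_closure_of[of X U] by blast
    ultimately have "\<sigma> ` (?N \<inter> U) \<inter> U \<noteq> {}"
      using openin_Int_closure_of_eq_empty[OF o, of U] by blast
    then show False
      using assms(2) by blast
  qed
  then show ?thesis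
    by (auto simp: displaced_def)
qed

text \<open>If \<open>x\<close> and \<open>\<sigma> x\<close> lie in the union of a directed family,
  then they lie in a single member. So a directed union of displaced sets is displaced, and
  regularizing it to get the supremum preserves this.\<close>

lemma closedin_displaced: "closedin (scott_space (RO X)) displaced"
proof -
  have "scott_open (RO X) (RO X - displaced)"
  proof (rule scott_openI)
    fix D s
    assume D: "D \<subseteq> RO X" "directed D" "isLub (RO X) D s" and s: "s \<in> RO X - displaced"
    show "\<exists>d\<in>D. d \<in> RO X - displaced"
    proof (rule ccontr)
      assume "\<not> ?thesis"
      then have sub: "D \<subseteq> displaced"
        using D(1) by blast
      have "\<sigma> x \<notin> \<Union>D" if x: "x \<in> \<Union>D" for x
      proof
        assume "\<sigma> x \<in> \<Union>D"
        then obtain a b where "a \<in> D" "x \<in> a" "b \<in> D" "\<sigma> x \<in> b"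
          using x by blast
        then obtain c where "c \<in> D" "x \<in> c" "\<sigma> x \<in> c"
          using D(2) unfolding directed_def by blast
        then show False
          using sub by (auto simp: displaced_def)
      qed
      moreover have "openin X (\<Union>D)"
        using D(1) by (rule openin_Union_RO)
      ultimately have "regularize X (\<Union>D) \<in> displaced"
        by (intro regularize_displaced)
      then have "s \<in> displaced"
        using isLub_RO_eq[OF D(1,3)] by simp
      then show False
        using s by blast
    qed
  qed (auto simp: displaced_def)
  then show ?thesis
    by (auto simp: closedin_def displaced_def)
qed

text \<open>Both \<open>U\<close> and its image have displaced regularizations, so a greatest
  element would contain a point together with its image.\<close>

lemma displaced_no_greatest:
  assumes U: "openin X U" "U \<noteq> {}" "\<And>x. x \<in> U \<Longrightarrow> \<sigma> x \<notin> U"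
    and "x \<in> displaced" "\<And>u. u \<in> displaced \<Longrightarrow> u \<subseteq> x"
  shows False
proof -
  have "\<sigma> y \<notin> \<sigma> ` U" if "y \<in> \<sigma> ` U" for y
    using that U(3) openin_subset[OF U(1)] involutive by (auto 4 4)
  then have "regularize X U \<subseteq> x" "regularize X (\<sigma> ` U) \<subseteq> x"
    using assms openin_image by (simp_all add: regularize_displaced)
  then have "U \<subseteq> x" "\<sigma> ` U \<subseteq> x"
    using subset_regularize[OF U(1)] subset_regularize[OF openin_image[OF U(1)]] by blast+
  then show False
    using assms(2,4) by (auto simp: displaced_def)
qed

text \<open>Removing the closure of \<open>e\<close> rather than \<open>e\<close> keeps the set
  open. For open \<open>e\<close> only the boundary is lost, which is nowhere dense and disappears
  under regularization.\<close>

definition splice :: "'a set \<Rightarrow> 'a set \<Rightarrow> 'a set \<Rightarrow> 'a set" where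
  "splice u v e = (u - X closure_of e) \<union> (v \<inter> e)"

lemma openin_splice: "openin X u \<Longrightarrow> openin X v \<Longrightarrow> openin X e \<Longrightarrow> openin X (splice u v e)"
  unfolding splice_def by (intro openin_Un openin_Int openin_diff) auto

text \<open>By invariance a point of \<open>u\<close> outside \<open>e\<close> is not sent into
  \<open>e\<close>, and a point of \<open>e\<close> stays in \<open>e\<close>. Hence a point and its
  image could only both belong to the part from \<open>u\<close> or both to the part from
  \<open>v\<close>.\<close>

lemma splice_displaced:
  assumes "u \<in> displaced" "v \<in> displaced" "openin X e" "invariant e"
  shows "regularize X (splice u v e) \<in> displaced"
proof (rule regularize_displaced)
  show "openin X (splice u v e)"
    using assms by (intro openin_splice) (auto simp: displaced_def RO_iff)
  fix x assume x: "x \<in> splice u v e"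
  have e: "e \<subseteq> X closure_of e"
    using assms(3) by (simp add: closure_of_subset openin_subset)
  have u: "u \<subseteq> topspace X"
    using assms(1) by (auto simp: displaced_def RO_iff dest: openin_subset)
  have "x \<in> e" if "\<sigma> x \<in> e" "x \<in> u"
    using that assms(4) involutive u unfolding invariant_def by force
  then show "\<sigma> x \<notin> splice u v e"
    using x assms e unfolding splice_def displaced_def invariant_def by blast
qed

text \<open>Since the complements of the closures of the \<open>G n\<close> fill up a dense set,
  cutting \<open>G n\<close> out of \<open>u\<close> removes arbitrarily little, and Scott openness
  of \<open>V\<close> tolerates this for some \<open>n\<close>.\<close>

lemma splice_extend:
  assumes V: "scott_open (RO X) V" and o: "openin X u" "openin X v" "openin X e"
    and G: "\<And>n. openin X (G n)" "decseq G"
      "X closure_of (\<Union>n. topspace X - X closure_of G n) = topspace X"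
    and e: "regularize X (splice u v e) \<in> V"
  shows "\<exists>n. regularize X (splice u v (e \<union> G n)) \<in> V"
proof -
  \<comment> \<open>The splice along \<open>e \<union> G n\<close> need not increase with
    \<open>n\<close>, because its part \<open>v \<inter> G n\<close> shrinks. Leaving out what
    \<open>v\<close> contributes on \<open>G n\<close> alone gives an increasing sequence below
    it.\<close>
  let ?F = "\<lambda>n. (u - X closure_of (e \<union> G n)) \<union> (v \<inter> e)"
  let ?E = "\<Union>n. topspace X - X closure_of G n"
  have F: "openin X (?F n)" for n
    using o by (intro openin_Un openin_Int openin_diff) auto
  have "incseq ?F"
    using G(2) unfolding incseq_def decseq_def
    by (intro allI impI Un_mono Diff_mono closure_of_mono) auto
  moreover have "splice u v e \<subseteq> X closure_of (\<Union>n. ?F n)"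
  proof -
    have "splice u v e \<inter> ?E \<subseteq> (\<Union>n. ?F n)"
      by (auto simp: splice_def)
    then have "X closure_of (splice u v e \<inter> ?E) \<subseteq> X closure_of (\<Union>n. ?F n)"
      by (rule closure_of_mono)
    then show ?thesis
      using openin_subset_closure_of_Int_dense[OF openin_splice[OF o] G(3)] by blast
  qed
  ultimately obtain n where n: "regularize X (?F n) \<in> V"
    using scott_open_RO_incseq[of X V ?F, OF V F _ _ e] by blast
  have "?F n \<subseteq> splice u v (e \<union> G n)"
    by (auto simp: splice_def)
  then show ?thesis
    using scott_open_upper[OF V n regularize_in_RO regularize_mono] by blast
qed

text \<open>The common element is \<open>regularize X (splice u v (e k))\<close> for a late stage
  \<open>k\<close>: every stage stays in \<open>V\<close> by construction, and the part copied from
  \<open>v\<close> alone eventually reaches \<open>W\<close>.\<close>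

lemma scott_open_meet_displaced:
  fixes G :: "nat \<Rightarrow> nat \<Rightarrow> 'a set"
  assumes G: "\<And>k n. openin X (G k n)" "\<And>k. decseq (G k)" "\<And>k n. invariant (G k n)"
    and small: "\<And>k. X closure_of (\<Union>n. topspace X - X closure_of G k n) = topspace X"
    and dense: "\<And>f. X closure_of (\<Union>k. G k (f k)) = topspace X"
    and V: "scott_open (RO X) V" "u \<in> V" "u \<in> displaced"
    and W: "scott_open (RO X) W" "v \<in> W" "v \<in> displaced"
  shows "V \<inter> W \<inter> displaced \<noteq> {}"
proof -
  have u: "openin X u" "regularize X u = u" and v: "openin X v" "regularize X v = v"
    using V W by (auto simp: displaced_def RO_iff)
  let ?P = "\<lambda>e. openin X e \<and> invariant e \<and> regularize X (splice u v e) \<in> V"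
  \<comment> \<open>Splicing along the empty set gives \<open>u\<close>, which starts the recursion.
    Stage \<open>k\<close> adds one \<open>G k n\<close>, with \<open>n\<close> so large that
    membership in \<open>V\<close> survives.\<close>
  have "\<exists>e. \<forall>k. ?P (e k) \<and> (\<exists>n. e (Suc k) = e k \<union> G k n)"
  proof (rule dependent_nat_choice)
    have "?P {}"
      using u V by (simp add: splice_def invariant_def)
    then show "\<exists>e. ?P e" ..
    fix e k assume e: "?P e"
    then obtain n where "regularize X (splice u v (e \<union> G k n)) \<in> V"
      using splice_extend[of V u v e "G k"] u v V G small by blast
    then have "?P (e \<union> G k n)"
      using e G by (auto simp: invariant_def)
    then show "\<exists>e'. ?P e' \<and> (\<exists>n. e' = e \<union> G k n)"
      by blast
  qed
  then obtain e f where e: "\<And>k. ?P (e k)" and f: "\<And>k. e (Suc k) = e k \<union> G k (f k)"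
    by metis
  have inc: "incseq e"
    by (rule incseq_SucI) (auto simp: f)
  \<comment> \<open>The indices \<open>f k\<close> were dictated by \<open>V\<close>; the hypothesis
    \<open>dense\<close> holds for every choice function, so the \<open>e k\<close> still exhaust a
    dense set.\<close>
  have "(\<Union>k. G k (f k)) \<subseteq> (\<Union>k. e k)"
    using f by blast
  then have "X closure_of (\<Union>k. e k) = topspace X"
    using dense[of f] closure_of_mono closure_of_subset_topspace subset_antisym by metis
  then have "v \<subseteq> X closure_of (v \<inter> (\<Union>k. e k))"
    using v by (simp add: openin_subset_closure_of_Int_dense)
  then have "v \<subseteq> X closure_of (\<Union>k. v \<inter> e k)"
    by simp
  moreover have "incseq (\<lambda>k. v \<inter> e k)"
    using inc by (auto simp: incseq_def)
  moreover have "openin X (v \<inter> e k)" for k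
    using v e by blast
  ultimately obtain k where k: "regularize X (v \<inter> e k) \<in> W"
    using scott_open_RO_incseq[of X W "\<lambda>k. v \<inter> e k" v] W v by auto
  have "regularize X (v \<inter> e k) \<subseteq> regularize X (splice u v (e k))"
    by (rule regularize_mono) (auto simp: splice_def)
  then have "regularize X (splice u v (e k)) \<in> W"
    using scott_open_upper[OF W(1) k] by simp
  then show ?thesis
    using e[of k] splice_displaced[OF V(3) W(3)] by blast
qed

text \<open>Irreducibility follows by applying the preceding lemma to the complements of two closed
  sets, neither of which contains \<open>displaced\<close>. A point whose closure is
  \<open>displaced\<close> would then be its greatest element.\<close>

theorem not_sober_RO:
  fixes G :: "nat \<Rightarrow> nat \<Rightarrow> 'a set"
  assumes G: "\<And>k n. openin X (G k n)" "\<And>k. decseq (G k)" "\<And>k n. invariant (G k n)"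
    and small: "\<And>k. X closure_of (\<Union>n. topspace X - X closure_of G k n) = topspace X"
    and dense: "\<And>f. X closure_of (\<Union>k. G k (f k)) = topspace X"
    and U: "openin X U" "U \<noteq> {}" "\<And>x. x \<in> U \<Longrightarrow> \<sigma> x \<notin> U"
  shows "\<not> sober_space (scott_space (RO X))"
proof
  let ?S = "scott_space (RO X)"
  assume sober: "sober_space ?S"
  have "irreducible_in ?S displaced"
    unfolding irreducible_in_def
  proof (intro conjI allI impI)
    show "displaced \<subseteq> topspace ?S"
      by (auto simp: displaced_def)
    show "displaced \<noteq> {}"
      using regularize_displaced[OF U(1,3)] by blast
    fix C1 C2
    assume C: "closedin ?S C1 \<and> closedin ?S C2 \<and> displaced \<subseteq> C1 \<union> C2"
    then have o: "scott_open (RO X) (RO X - C1)" "scott_open (RO X) (RO X - C2)"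
      by (simp_all add: closedin_def)
    show "displaced \<subseteq> C1 \<or> displaced \<subseteq> C2"
    proof (rule ccontr)
      assume "\<not> ?thesis"
      then obtain u v where "u \<in> displaced" "u \<in> RO X - C1" "v \<in> displaced" "v \<in> RO X - C2"
        by (auto simp: displaced_def)
      then have "(RO X - C1) \<inter> (RO X - C2) \<inter> displaced \<noteq> {}"
        using scott_open_meet_displaced[OF G small dense o(1) _ _ o(2)] by blast
      then show False
        using C by blast
    qed
  qed
  then obtain x where x: "x \<in> RO X" "displaced = ?S closure_of {x}"
    using sober closedin_displaced unfolding sober_space_def by auto
  then have "x \<in> displaced"
    by (metis closure_of_subset empty_subsetI insert_subset topspace_scott_space)
  moreover have "u \<subseteq> x" if "u \<in> displaced" for u
    using scott_closure_of_singleton_le[OF x(1)] x(2) that by blast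
  ultimately show False
    using displaced_no_greatest[OF U] by blast
qed

end

section \<open>Euclidean space and the Cantor space\<close>

theorem not_sober_RO_euclidean:
  "\<not> sober_space (scott_space (RO (euclidean :: 'a::euclidean_space topology)))"
proof -
  interpret displacing_involution "euclidean :: 'a topology" uminus
    by standard (auto intro: continuous_intros)
  obtain Q :: "'a set" where Q: "countable Q" "\<And>S. open S \<Longrightarrow> S \<noteq> {} \<Longrightarrow> \<exists>q\<in>Q. q \<in> S"
    using countable_dense_exists by blast
  have Q_ne: "Q \<noteq> {}"
    using Q(2)[OF open_UNIV] by blast
  define q where "q = from_nat_into Q"
  \<comment> \<open>The second ball makes the set invariant under negation.\<close>
  define G where "G k n = ball (q k) (1 / real (Suc n)) \<union> ball (- q k) (1 / real (Suc n))" for k n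
  \<comment> \<open>A basis vector exists because the dimension is positive. Negation moves the open
    half-space it defines off itself.\<close>
  obtain b :: 'a where b: "b \<in> Basis"
    using nonempty_Basis by blast
  show ?thesis
  proof (rule not_sober_RO[of G "{x. b \<bullet> x > 0}"])
    show "openin euclidean (G k n)" for k n
      by (auto simp: G_def)
    show "decseq (G k)" for k
      unfolding decseq_def G_def
      by (intro allI impI Un_mono subset_ball) (simp_all add: frac_le)
    show "invariant (G k n)" for k n
      by (auto simp: invariant_def G_def dist_norm norm_minus_commute add.commute)
    show "euclidean closure_of (\<Union>n. topspace euclidean - euclidean closure_of G k n)
        = topspace euclidean" for k
    proof -
      \<comment> \<open>As the radii tend to zero, the closures shrink to the centres
        \<open>q k\<close> and \<open>- q k\<close>, a finite set with empty interior.\<close>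
      have "x \<in> (\<Union>n. - closure (G k n))" if x: "x \<notin> {q k, - q k}" for x
      proof -
        obtain n where n: "1 / real (Suc n) < min (dist (q k) x) (dist (- q k) x)"
          using x nat_approx_posE[of "min (dist (q k) x) (dist (- q k) x)"] by auto
        have "closure (G k n) \<subseteq> cball (q k) (1 / real (Suc n)) \<union> cball (- q k) (1 / real (Suc n))"
          by (intro closure_minimal) (auto simp: G_def)
        then have "x \<notin> closure (G k n)"
          using n by auto
        then show ?thesis
          by blast
      qed
      then have "- {q k, - q k} \<subseteq> (\<Union>n. - closure (G k n))"
        by blast
      moreover have "interior {q k, - q k} = {}"
        using interior_closed_Un_empty_interior[of "{q k}" "{- q k}"]
        by (simp add: insert_commute)
      then have "closure (- {q k, - q k}) = UNIV"
        by (simp add: closure_complement)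
      ultimately have "closure (\<Union>n. - closure (G k n)) = UNIV"
        by (metis closure_mono top.extremum_uniqueI)
      then show ?thesis
        by (simp add: Compl_eq_Diff_UNIV)
    qed
    show "euclidean closure_of (\<Union>k. G k (f k)) = topspace euclidean" for f
    proof -
      have "(\<Union>k. G k (f k)) \<inter> S \<noteq> {}" if S: "open S" "S \<noteq> {}" for S
      proof -
        obtain k where "q k \<in> S"
          using Q Q_ne S unfolding q_def by (metis from_nat_into_surj)
        moreover have "q k \<in> G k (f k)"
          by (simp add: G_def)
        ultimately show ?thesis
          by blast
      qed
      then show ?thesis
        unfolding dense_intersects_open by simp
    qed
    show "openin euclidean {x. b \<bullet> x > 0}"
      by (simp add: open_halfspace_gt)
    show "{x. b \<bullet> x > 0} \<noteq> {}"
      using b by (auto intro!: exI[of _ b] simp: inner_Basis)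
  qed auto
qed

section \<open>The Cantor space\<close>

lemma topspace_cantor_space: "topspace cantor_space = {x. \<forall>i. x i \<in> {0, 1}}"
  by (simp add: cantor_space_def PiE_UNIV_domain Pi_def)

lemma openin_cantor_space_cylinder: "openin cantor_space {x \<in> topspace cantor_space. x i = c}"
proof -
  have "continuous_map cantor_space (discrete_topology {0, 1}) (\<lambda>x. x i)"
    unfolding cantor_space_def by (rule continuous_map_product_projection) simp
  then have "openin cantor_space {x \<in> topspace cantor_space. x i \<in> {c} \<inter> {0, 1}}"
    by (rule openin_continuous_map_preimage) auto
  then show ?thesis
    by (rule back_subst[of "openin cantor_space"]) (auto simp: topspace_cantor_space)
qed

lemma openin_cantor_spaceE:
  assumes "openin cantor_space S" "x \<in> S"
  obtains F where "finite F"
    "\<And>y. y \<in> topspace cantor_space \<Longrightarrow> (\<And>i. i \<in> F \<Longrightarrow> y i = x i) \<Longrightarrow> y \<in> S"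
proof -
  obtain U where U: "finite {i. U i \<noteq> {0, 1 :: nat}}" "x \<in> PiE UNIV U" "PiE UNIV U \<subseteq> S"
    using assms unfolding cantor_space_def openin_product_topology_alt by auto
  show thesis
  proof (rule that[OF U(1)])
    fix y assume y: "y \<in> topspace cantor_space" "\<And>i. i \<in> {i. U i \<noteq> {0, 1}} \<Longrightarrow> y i = x i"
    have "y i \<in> U i" for i
      using y U(2) by (cases "U i = {0, 1}") (auto simp: topspace_cantor_space PiE_iff)
    then show "y \<in> S"
      using U(3) by auto
  qed
qed

theorem not_sober_RO_cantor_space: "\<not> sober_space (scott_space (RO cantor_space))"
proof -
  let ?C = cantor_space
  \<comment> \<open>Subtraction on \<open>nat\<close> is truncated, but on the values 0 and 1 it
    swaps the two.\<close>
  define flip :: "(nat \<Rightarrow> nat) \<Rightarrow> nat \<Rightarrow> nat" where "flip x = x(0 := 1 - x 0)" for x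
  have flip: "continuous_map ?C ?C flip"
  proof -
    have "continuous_map ?C (discrete_topology {0, 1}) (\<lambda>x. flip x i)" for i
    proof -
      have proj: "continuous_map ?C (discrete_topology {0, 1}) (\<lambda>x. x i)"
        unfolding cantor_space_def by (rule continuous_map_product_projection) simp
      have "continuous_map ?C (discrete_topology {0, 1}) ((\<lambda>t. 1 - t) \<circ> (\<lambda>x. x i))"
        by (rule continuous_map_compose[OF proj]) auto
      with proj show ?thesis
        by (cases "i = 0") (simp_all add: flip_def o_def)
    qed
    then show ?thesis
      by (subst (2) cantor_space_def) (simp add: continuous_map_componentwise_UNIV)
  qed
  interpret displacing_involution ?C flip
    by standard (use flip in \<open>auto simp: flip_def topspace_cantor_space fun_eq_iff\<close>,
        metis One_nat_def diff_diff_cancel le_numeral_extra(4) less_one zero_le)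
  \<comment> \<open>\<open>set_decode\<close> enumerates the finite sets of naturals, so the
    \<open>q k\<close> are exactly the sequences with finitely many ones, a countable dense
    set.\<close>
  define q :: "nat \<Rightarrow> nat \<Rightarrow> nat" where "q k i = (if i \<in> set_decode k then 1 else 0)" for k i
  \<comment> \<open>The prescribed coordinates start at 1: coordinate 0 stays free, which makes
    these sets invariant under \<open>flip\<close>. For \<open>n = 0\<close> the intersection is
    over no cylinders and the whole space remains.\<close>
  define G where "G k n = topspace ?C \<inter> (\<Inter>i\<in>{1..n}. {x \<in> topspace ?C. x i = q k i})" for k n
  have G_iff: "x \<in> G k n \<longleftrightarrow> x \<in> topspace ?C \<and> (\<forall>i\<in>{1..n}. x i = q k i)" for x k n
    by (auto simp: G_def)
  show ?thesis
  proof (rule not_sober_RO[of G "{x \<in> topspace ?C. x 0 = 1}"])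
    show "openin ?C (G k n)" for k n
    proof (cases "n = 0")
      case False
      then show ?thesis
        unfolding G_def by (intro openin_Int openin_INT2 openin_cantor_space_cylinder) auto
    qed (simp add: G_def)
    show "decseq (G k)" for k
      by (auto simp: decseq_def G_iff)
    show "invariant (G k n)" for k n
      by (auto simp: invariant_def G_iff flip_def topspace_cantor_space)
    show "?C closure_of (\<Union>n. topspace ?C - ?C closure_of G k n) = topspace ?C" for k
    proof -
      have "(\<Union>n. topspace ?C - ?C closure_of G k n) \<inter> S \<noteq> {}"
        if S: "openin ?C S" "S \<noteq> {}" for S
      proof -
        obtain x where x: "x \<in> S"
          using S(2) by blast
        obtain F where F: "finite F"
          "\<And>y. y \<in> topspace ?C \<Longrightarrow> (\<And>i. i \<in> F \<Longrightarrow> y i = x i) \<Longrightarrow> y \<in> S"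
          using openin_cantor_spaceE[OF S(1) x] by blast
        \<comment> \<open>Changing \<open>x\<close> at a coordinate outside \<open>F\<close> does
          not leave \<open>S\<close>. Since \<open>i\<close> is also nonzero, it is among the
          coordinates prescribed by \<open>G k i\<close>, so disagreeing with \<open>q k\<close>
          there puts the new point in a cylinder disjoint from \<open>G k i\<close>.\<close>
        obtain i where i: "i \<notin> insert 0 F"
          using ex_new_if_finite[of "insert 0 F"] F(1) by auto
        let ?y = "x(i := 1 - q k i)"
        have y: "?y \<in> topspace ?C"
          using x openin_subset[OF S(1)] by (auto simp: topspace_cantor_space)
        have "{z \<in> topspace ?C. z i = 1 - q k i} \<inter> G k i = {}"
          using i by (auto simp: G_iff q_def split: if_splits)
        then have "?y \<notin> ?C closure_of G k i"
          using y openin_cantor_space_cylinder[of i "1 - q k i"]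
          by (auto simp: in_closure_of disjoint_iff
              intro!: exI[of _ "{z \<in> topspace ?C. z i = 1 - q k i}"])
        moreover have "?y \<in> S"
          using i by (intro F(2)[OF y]) auto
        ultimately show ?thesis
          using y by blast
      qed
      then show ?thesis
        unfolding dense_intersects_open by simp
    qed
    show "?C closure_of (\<Union>k. G k (f k)) = topspace ?C" for f
    proof -
      have "(\<Union>k. G k (f k)) \<inter> S \<noteq> {}" if S: "openin ?C S" "S \<noteq> {}" for S
      proof -
        obtain x where x: "x \<in> S"
          using S(2) by blast
        obtain F where F: "finite F"
          "\<And>y. y \<in> topspace ?C \<Longrightarrow> (\<And>i. i \<in> F \<Longrightarrow> y i = x i) \<Longrightarrow> y \<in> S"
          using openin_cantor_spaceE[OF S(1) x] by blast
        \<comment> \<open>This \<open>k\<close> codes the positions in \<open>F\<close> where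
          \<open>x\<close> is 1, so \<open>q k\<close> agrees with \<open>x\<close> on
          \<open>F\<close> and hence lies in \<open>S\<close>.\<close>
        define k where "k = set_encode {i \<in> F. x i = 1}"
        have q: "q k \<in> topspace ?C"
          by (auto simp: q_def topspace_cantor_space)
        have "x \<in> topspace ?C"
          using x openin_subset[OF S(1)] by blast
        then have "q k i = x i" if "i \<in> F" for i
          using that F(1) by (auto simp: q_def k_def topspace_cantor_space)
        then have "q k \<in> S"
          using F(2) q by blast
        moreover have "q k \<in> G k (f k)"
          using q by (simp add: G_iff)
        ultimately show ?thesis
          by blast
      qed
      then show ?thesis
        unfolding dense_intersects_open by simp
    qed
    show "openin ?C {x \<in> topspace ?C. x 0 = 1}"
      by (rule openin_cantor_space_cylinder)
    have "(\<lambda>_. 1) \<in> {x \<in> topspace ?C. x 0 = 1}"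
      by (simp add: topspace_cantor_space)
    then show "{x \<in> topspace ?C. x 0 = 1} \<noteq> {}"
      by blast
  qed (auto simp: flip_def)
qed

text \<open>Index types are nonempty, so \<open>real ^ 'n\<close> with finite \<open>'n\<close>
  ranges over the Euclidean spaces of positive dimension.\<close>

theorem corollary4p14:
  shows "\<not> sober_space (scott_space (RO (euclidean :: (real ^ 'n::finite) topology))) \<and>
         \<not> sober_space (scott_space (RO cantor_space))"
  using not_sober_RO_euclidean not_sober_RO_cantor_space by blast

end
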